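(* Let $q\in[1,\infty)$ and let $k=k(n)$ satisfy $1\ll k\le\log n/\log\log n$ as $n\to\infty$. Let $\omega:=\max\{(\log k)^2,\,k/n^{1/(2k)}\}$, and let $R_{k,q}$ be the minimal integer with $|B_{k,q}(R_{k,q})|\ge n e^{\omega}$. Let $\mathfrak{M}_{k,q}:=k^{1/q}n^{1/k}/C_q$ with $C_q:=2\,\Gamma(1/q+1)\,(qe)^{1/q}$, let $K$ be a sufficiently large constant and let $\xi:=1-e^{-K\omega/k}$. Then (for $n$ sufficiently large) $$R_{k,q}\le\bigl\lfloor\mathfrak{M}_{k,q}(1+\xi)\bigr\rfloor\qquad\text{and}\qquad\bigl|B_{k,q}\bigl(\mathfrak{M}_{k,q}(1-\xi)\bigr)\bigr|\ll n.$$
   Context: $B_{k,q}(R):=\{a\in\mathbb{Z}^k:\sum_{i=1}^k|a_i|^q\le R^q\}$ and $|B|$ is the number of elements of $B$. Asymptotic notation is as $n\to\infty$: $a\ll b$ means $a/b\to0$. Logarithms are natural and $\Gamma$ is the Gamma function. *)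

theory Defs
  imports "HOL-Analysis.Analysis" "HOL-Library.Landau_Symbols"
begin

(* Elements of Z^k are extensional functions on {..<k}.  Only radii R >= 0 are meaningful. *)
definition lattice_ball :: "nat \<Rightarrow> real \<Rightarrow> real \<Rightarrow> (nat \<Rightarrow> int) set" where
  "lattice_ball k q R =
     {a \<in> {..<k} \<rightarrow>\<^sub>E UNIV. (\<Sum>i<k. \<bar>real_of_int (a i)\<bar> powr q) \<le> R powr q}"

(* Ensures that card counts the points, since card is 0 on infinite sets. *)
lemma finite_lattice_ball:
  assumes "1 \<le> q" "0 \<le> R"
  shows "finite (lattice_ball k q R)"
proof (rule finite_subset)
  let ?I = "{-\<lfloor>R\<rfloor>..\<lfloor>R\<rfloor>}"
  show "lattice_ball k q R \<subseteq> ({..<k} \<rightarrow>\<^sub>E ?I)"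
  proof
    fix a assume a: "a \<in> lattice_ball k q R"
    have "a i \<in> ?I" if i: "i < k" for i
    proof -
      have "\<bar>real_of_int (a i)\<bar> powr q \<le> (\<Sum>i<k. \<bar>real_of_int (a i)\<bar> powr q)"
        using i by (intro member_le_sum) auto
      also have "\<dots> \<le> R powr q"
        using a by (simp add: lattice_ball_def)
      finally have "\<bar>real_of_int (a i)\<bar> \<le> R"
        using assms by (meson abs_ge_zero linorder_not_less powr_less_mono2 less_le_trans zero_less_one)
      then have "real_of_int \<bar>a i\<bar> \<le> R"
        by simp
      then have "\<bar>a i\<bar> \<le> \<lfloor>R\<rfloor>"
        by (simp only: le_floor_iff)
      then show ?thesis by auto
    qed
    then show "a \<in> {..<k} \<rightarrow>\<^sub>E ?I"
      using a by (auto simp: lattice_ball_def PiE_iff)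
  qed
  show "finite ({..<k} \<rightarrow>\<^sub>E ?I)"
    by (intro finite_PiE) auto
qed

definition omega :: "nat \<Rightarrow> nat \<Rightarrow> real" where
  "omega n k = max ((ln (real k))\<^sup>2) (real k / real n powr (1 / (2 * real k)))"

(* The radius ranges over the nonnegative integers, as R^q is only meaningful for R >= 0.
   The minimum exists as soon as k >= 1. *)
definition min_radius :: "nat \<Rightarrow> nat \<Rightarrow> real \<Rightarrow> nat" where
  "min_radius n k q =
     (LEAST R. real n * exp (omega n k) \<le> real (card (lattice_ball k q (real R))))"

definition C_const :: "real \<Rightarrow> real" where
  "C_const q = 2 * Gamma (1 / q + 1) * (q * exp 1) powr (1 / q)"

definition frakM :: "nat \<Rightarrow> nat \<Rightarrow> real \<Rightarrow> real" where
  "frakM n k q = real k powr (1 / q) * real n powr (1 / real k) / C_const q"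

definition xi :: "real \<Rightarrow> nat \<Rightarrow> nat \<Rightarrow> real" where
  "xi K n k = 1 - exp (- K * omega n k / real k)"

end

theory Submission
  imports Defs
begin

text \<open>
Write \<open>C = C_const q\<close>, \<open>L = n\<^bsup>1/k\<^esup>\<close> and \<open>M = frakM n k q = k\<^bsup>1/q\<^esup> L / C\<close>.  The radius \<open>M\<close> is
chosen so that the heuristic count \<open>(C R / k\<^bsup>1/q\<^esup>)\<^sup>k\<close> of lattice points in the ball of radius \<open>R\<close>
equals \<open>n\<close> at \<open>R = M\<close>.  The true count differs from the heuristic one by a factor
\<open>exp (O(\<omega>))\<close>, whereas multiplying the radius by \<open>1 \<plusminus> \<xi>\<close> changes the count by a factor of about
\<open>exp (\<plusminus> K \<omega>)\<close>; for large \<open>K\<close> the second effect wins.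

The upper bound on the count (\<open>card_lattice_ball_le\<close>) is an exponential-moment estimate: every
point of the ball contributes at least \<open>1\<close> to \<open>exp (s R\<^sup>q) * (\<Sum>z. exp (- s \<bar>z\<bar>\<^sup>q))\<^sup>k\<close>, the sum over the
integers is at most \<open>1 + 2 \<Gamma>(1/q + 1) s\<^bsup>-1/q\<^esup>\<close> by comparison with an integral, and
\<open>s = k / (q R\<^sup>q)\<close> turns this into \<open>(e\<^bsup>1/q\<^esup> + C R / k\<^bsup>1/q\<^esup>)\<^sup>k\<close>.

The lower bound (\<open>card_lattice_ball_ge\<close>) is the volume of a ball of radius \<open>R - k\<^bsup>1/q\<^esup>\<close>, as it
should be since rounding coordinates away from zero moves a point by at most \<open>k\<^bsup>1/q\<^esup>\<close> in the
\<open>q\<close>-norm.  No volume is computed: the estimate is proved by induction on the dimension, slicing along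
one coordinate and comparing the sum over slices with a Beta integral, so that the Gamma factors
of the volume formula telescope.  A crude form of Stirling's formula for \<open>\<Gamma>(k/q + 1)\<close> then
costs only a factor linear in \<open>k\<close>.

Three errors have to be absorbed.  The factor linear in \<open>k\<close> is at most \<open>e\<^sup>\<omega>\<close> because
\<open>\<omega> \<ge> (ln k)\<^sup>2\<close>.  The terms \<open>e\<^bsup>1/q\<^esup>\<close> and \<open>k\<^bsup>1/q\<^esup>\<close>, as well as the rounding of the radius, change the
base of the \<open>k\<close>-th power by a relative amount \<open>O(1/L)\<close>, hence the count by \<open>exp (O(k/L))\<close>, and
\<open>k/L \<le> k / n\<^bsup>1/(2k)\<^esup> \<le> \<omega>\<close>.  The bound on \<open>k\<close> yields \<open>L \<ge> ln n\<close>; hence \<open>\<omega>/k\<close> tends to \<open>0\<close>,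
which justifies linearising the exponentials.
\<close>

section \<open>Integrals of functions of a power\<close>

lemma Gamma_plus1_pos: "0 < x \<Longrightarrow> Gamma (x + 1) = x * Gamma (x :: real)"
  by (intro Gamma_plus1) (auto elim!: nonpos_Ints_cases)

text \<open>
This is the substitution \<open>t = c x\<^sup>q\<close>.  For \<open>q > 1\<close> the weight \<open>t\<^bsup>1/q - 1\<^esup>\<close> is singular at \<open>0\<close>, which is why
the set \<open>X\<close> is kept inside the open half-line.
\<close>

lemma has_integral_power_substitution:
  fixes h :: "real \<Rightarrow> real"
  assumes "0 < q" "0 < c" and X: "X \<in> sets lebesgue" "X \<subseteq> {0<..}"
    and h: "\<And>x. x \<in> X \<Longrightarrow> 0 \<le> h (c * x powr q)"
    and I: "((\<lambda>t. t powr (1/q - 1) * h t) has_integral I) ((\<lambda>x. c * x powr q) ` X)"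
  shows "((\<lambda>x. h (c * x powr q)) has_integral I / (q * c powr (1/q))) X"
proof -
  let ?g = "\<lambda>x. c * x powr q" and ?g' = "\<lambda>x. c * (q * x powr (q - 1))"
  let ?f = "\<lambda>t. t powr (1/q - 1) * h t"
  have der: "(?g has_field_derivative ?g' x) (at x within X)" if "x \<in> X" for x
    using that X by (auto intro!: derivative_eq_intros simp: has_field_derivative_at_within)
  have inj: "inj_on ?g X"
  proof (rule strict_mono_on_imp_inj_on[of X ?g])
    show "strict_mono_on X ?g"
      using assms(1,2) X by (auto intro!: strict_mono_onI powr_less_mono2 simp: less_imp_le dest!: subsetD)
  qed
  have "?f absolutely_integrable_on (?g ` X)"
    using I h by (intro nonnegative_absolutely_integrable_1) (auto simp: has_integral_integrable)
  then have *: "(\<lambda>x. \<bar>?g' x\<bar> * ?f (?g x)) absolutely_integrable_on X \<and>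
         integral X (\<lambda>x. \<bar>?g' x\<bar> * ?f (?g x)) = I"
    using has_absolute_integral_change_of_variables_1'[OF X(1) der inj, of ?f I] I
    by (simp add: integral_unique)
  have "((\<lambda>x. \<bar>?g' x\<bar> * ?f (?g x)) has_integral I) X"
    using * set_lebesgue_integral_eq_integral(1)[of X "\<lambda>x. \<bar>?g' x\<bar> * ?f (?g x)"]
    unfolding has_integral_iff by auto
  moreover have "\<bar>?g' x\<bar> * ?f (?g x) = (q * c powr (1/q)) * h (?g x)" if "x \<in> X" for x
  proof -
    have x: "x > 0" using that X by auto
    have "?g x powr (1/q - 1) = c powr (1/q - 1) * x powr (1 - q)"
      using x assms(1,2) by (simp add: powr_mult powr_powr right_diff_distrib)
    moreover have "x powr (q - 1) * x powr (1 - q) = 1" "c * c powr (1/q - 1) = c powr (1/q)"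
      using x assms(1,2) by (simp_all flip: powr_add add: powr_mult_base)
    moreover have "c * (q * A) * (C * B * H) = q * (c * C) * (A * B) * H" for A B C H :: real
      by (simp only: mult_ac)
    moreover have "\<bar>?g' x\<bar> = ?g' x"
      using assms(1,2) by (intro abs_of_nonneg) auto
    ultimately show ?thesis by (simp only: mult_1_right)
  qed
  ultimately have "((\<lambda>x. (q * c powr (1/q)) * h (?g x)) has_integral I) X"
    by (rule has_integral_eq_rhs[OF has_integral_eq[rotated]]) auto
  from has_integral_mult_right[OF this, of "1 / (q * c powr (1/q))"] show ?thesis
    using assms(1,2) by simp
qed

lemma has_integral_exp_minus_powr:
  fixes q s :: real
  assumes "0 < q" "0 < s"
  shows "((\<lambda>x. exp (- (s * x powr q))) has_integral Gamma (1/q + 1) / s powr (1/q)) {0<..}"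
proof -
  have im: "(\<lambda>x. s * x powr q) ` {0<..} = {0<..}"
  proof -
    have "y \<in> (\<lambda>x. s * x powr q) ` {0<..}" if "0 < y" for y
      using that assms by (intro image_eqI[where x = "(y / s) powr (1/q)"]) (auto simp: powr_powr)
    then show ?thesis using assms by auto
  qed
  have "((\<lambda>t. t powr (1/q - 1) / exp t) has_integral Gamma (1/q)) {0..}"
    using assms by (intro Gamma_integral_real) auto
  then have "((\<lambda>t. t powr (1/q - 1) / exp t) has_integral Gamma (1/q)) {0<..}"
    by (subst (asm) has_integral_spike_set_eq[where T = "{0<..}"])
       (auto intro: negligible_subset[of "{0}"])
  then have "((\<lambda>t. t powr (1/q - 1) * exp (- t)) has_integral Gamma (1/q)) ((\<lambda>x. s * x powr q) ` {0<..})"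
    unfolding im by (simp add: exp_minus divide_inverse)
  from has_integral_power_substitution[OF assms _ _ _ this]
  have "((\<lambda>x. exp (- (s * x powr q))) has_integral Gamma (1/q) / (q * s powr (1/q))) {0<..}"
    by auto
  moreover have "Gamma (1/q + 1) = Gamma (1/q) / q"
    using assms by (simp add: Gamma_plus1_pos)
  ultimately show ?thesis by simp
qed

lemma powr_less_iff_less_powr_inverse:
  fixes q x S :: real
  assumes "0 < q" "0 \<le> x" "0 \<le> S"
  shows "x powr q < S \<longleftrightarrow> x < S powr (1/q)"
proof -
  have S: "(S powr (1/q)) powr q = S"
    using assms by (simp add: powr_powr)
  show ?thesis
  proof
    assume "x powr q < S"
    then show "x < S powr (1/q)"
      using powr_mono2[of q "S powr (1/q)" x] assms S by (cases "x < S powr (1/q)") auto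
  next
    assume "x < S powr (1/q)"
    then show "x powr q < S"
      using powr_less_mono2[of q x "S powr (1/q)"] assms S by simp
  qed
qed

text \<open>
Up to a constant factor, with \<open>r = k/q\<close>, the integrand is the volume of the slice at
height \<open>x\<close> of the \<open>(k + 1)\<close>-dimensional ball \<open>{\<Sum>x\<^sub>i\<^sup>q \<le> S}\<close>.  The Gamma quotient is the ratio of
consecutive coefficients \<open>\<Gamma>(1/q + 1)\<^sup>k / \<Gamma>(k/q + 1)\<close> in the volume formula, which makes the product over
the dimensions telescope.
\<close>

lemma has_integral_powr_section:
  fixes q r S b :: real
  assumes "0 < q" "0 \<le> r" "0 < S" "S powr (1/q) \<le> b"
  shows "((\<lambda>x. max 0 (S - x powr q) powr r) has_integral
           Gamma (1/q + 1) * Gamma (r + 1) / Gamma (r + 1 + 1/q) * S powr (r + 1/q)) {0..b}"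
proof -
  let ?B = "Beta (1/q) (r + 1)" and ?X = "{0<..<S powr (1/q)}" and ?g = "\<lambda>x. (1/S) * x powr q"
  note bd = powr_less_iff_less_powr_inverse[OF assms(1) _ less_imp_le[OF assms(3)]]
  have im: "?g ` ?X = {0<..<1}"
  proof (intro equalityI subsetI)
    fix y :: real assume y: "y \<in> {0<..<1}"
    show "y \<in> ?g ` ?X"
      using y assms by (intro image_eqI[where x = "(S * y) powr (1/q)"])
        (auto simp: powr_powr intro!: powr_less_mono2)
  qed (use assms bd in auto)
  have "((\<lambda>t. t powr (1/q - 1) * (1 - t) powr (r + 1 - 1)) has_integral ?B) {0..1}"
    using assms by (intro has_integral_Beta_real) auto
  then have "((\<lambda>t. t powr (1/q - 1) * (1 - t) powr r * S powr r) has_integral ?B * S powr r) {0<..<1}"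
    by (intro has_integral_mult_left) (simp add: has_integral_Icc_iff_Ioo)
  then have "((\<lambda>t. t powr (1/q - 1) * ((1 - t) powr r * S powr r)) has_integral ?B * S powr r) (?g ` ?X)"
    unfolding im by (simp add: mult.assoc)
  from has_integral_power_substitution[OF assms(1) _ _ _ _ this]
  have "((\<lambda>x. (1 - 1/S * x powr q) powr r * S powr r) has_integral
           ?B * S powr r / (q * (1/S) powr (1/q))) ?X"
    using assms by (simp add: subset_eq)
  moreover have "(1 - 1/S * x powr q) powr r * S powr r = max 0 (S - x powr q) powr r" if "x \<in> ?X" for x
  proof -
    have "x powr q < S" using bd[of x] that by auto
    then show ?thesis using assms
      by (simp add: powr_mult[symmetric] algebra_simps)
  qed
  ultimately have "((\<lambda>x. max 0 (S - x powr q) powr r) has_integral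
           ?B * S powr r / (q * (1/S) powr (1/q))) ?X"
    by (rule has_integral_eq[rotated])
  then have "((\<lambda>x. max 0 (S - x powr q) powr r) has_integral
           ?B * S powr r / (q * (1/S) powr (1/q))) {0..S powr (1/q)}"
    by (simp add: has_integral_Icc_iff_Ioo)
  then have "((\<lambda>x. max 0 (S - x powr q) powr r) has_integral
           ?B * S powr r / (q * (1/S) powr (1/q)) + 0) {0..b}"
  proof (rule has_integral_combine[OF powr_ge_zero assms(4)])
    show "((\<lambda>x. max 0 (S - x powr q) powr r) has_integral 0) {S powr (1/q)..b}"
    proof (rule has_integral_is_0)
      fix x assume "x \<in> {S powr (1/q)..b}"
      then have "\<not> x powr q < S" using bd[of x] by (auto intro: order_trans[OF powr_ge_zero])
      then show "max 0 (S - x powr q) powr r = 0" by auto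
    qed
  qed
  moreover have "?B * S powr r / (q * (1/S) powr (1/q)) =
      Gamma (1/q + 1) * Gamma (r + 1) / Gamma (r + 1 + 1/q) * S powr (r + 1/q)"
  proof -
    have "Gamma (1/q + 1) = Gamma (1/q) / q"
      using assms by (simp add: Gamma_plus1_pos)
    then show ?thesis
      using assms by (simp add: Beta_def powr_add powr_divide add_ac mult_ac)
  qed
  ultimately show ?thesis by simp
qed

section \<open>Comparison of sums with integrals\<close>

lemma integral_le_sum_of_upper_bounds:
  fixes g :: "real \<Rightarrow> real"
  assumes "g integrable_on {0..real m}"
    and "\<And>a x. \<lbrakk>a < m; real a \<le> x; x \<le> real a + 1\<rbrakk> \<Longrightarrow> g x \<le> u a"
  shows "integral {0..real m} g \<le> (\<Sum>a<m. u a)"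
  using assms
proof (induction m)
  case (Suc m)
  have int: "g integrable_on {0..real m}" "g integrable_on {real m..real (Suc m)}"
    using Suc.prems(1) by (auto intro: integrable_subinterval_real)
  have "integral {0..real (Suc m)} g = integral {0..real m} g + integral {real m..real (Suc m)} g"
    using Suc.prems(1) by (subst Henstock_Kurzweil_Integration.integral_combine) auto
  also have "integral {0..real m} g \<le> (\<Sum>a<m. u a)"
    using int Suc.prems(2) by (intro Suc.IH) auto
  also have "integral {real m..real (Suc m)} g \<le> integral {real m..real (Suc m)} (\<lambda>_. u m)"
    using int Suc.prems(2) by (intro integral_le) auto
  finally show ?case by simp
qed simp

lemma sum_exp_minus_powr_le:
  fixes q s :: real
  assumes "0 < q" "0 < s"
  shows "(\<Sum>a<m. exp (- (s * real (Suc a) powr q))) \<le> Gamma (1/q + 1) / s powr (1/q)"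
proof -
  let ?g = "\<lambda>x. exp (- (s * x powr q))"
  have int: "?g integrable_on {0..real m}"
    using assms by (intro integrable_continuous_real continuous_intros continuous_on_powr') auto
  have "integral {0..real m} (\<lambda>x. - ?g x) \<le> (\<Sum>a<m. - ?g (real (Suc a)))"
    using assms int by (intro integral_le_sum_of_upper_bounds) (auto intro!: powr_mono2 integrable_neg)
  then have "(\<Sum>a<m. ?g (real (Suc a))) \<le> integral {0..real m} ?g"
    by (simp add: sum_negf)
  also have "\<dots> = integral {0<..real m} ?g"
    by (rule integral_spike_set) (auto intro: negligible_subset[of "{0}"])
  also have "\<dots> \<le> integral {0<..} ?g"
  proof (rule integral_subset_le)
    show "?g integrable_on {0<..real m}"
      by (rule integrable_spike_set[OF int]) (auto intro: negligible_subset[of "{0}"])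
  qed (use has_integral_exp_minus_powr[OF assms] in auto)
  also have "\<dots> = Gamma (1/q + 1) / s powr (1/q)"
    using has_integral_exp_minus_powr[OF assms] by (rule integral_unique)
  finally show ?thesis .
qed

section \<open>Upper bound for the number of lattice points\<close>

text \<open>
The ball in terms of the \<open>q\<close>-th power of its radius, so that fixing one coordinate \<open>z\<close> replaces the
bound \<open>T\<close> by \<open>T - \<bar>z\<bar>\<^sup>q\<close>, which may be negative.
\<close>

definition power_ball :: "nat \<Rightarrow> real \<Rightarrow> real \<Rightarrow> (nat \<Rightarrow> int) set" where
  "power_ball k q T = {a \<in> {..<k} \<rightarrow>\<^sub>E UNIV. (\<Sum>i<k. \<bar>real_of_int (a i)\<bar> powr q) \<le> T}"

lemma lattice_ball_eq_power_ball: "lattice_ball k q R = power_ball k q (R powr q)"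
  by (simp add: lattice_ball_def power_ball_def)

lemma power_ball_mono:
  assumes "T \<le> U"
  shows "power_ball k q T \<subseteq> power_ball k q U"
  unfolding power_ball_def using assms order_trans by (intro Collect_mono) blast

lemma finite_power_ball:
  assumes "1 \<le> q"
  shows "finite (power_ball k q T)"
proof -
  define R where "R = max 0 T powr (1/q)"
  have "R powr q = max 0 T"
    unfolding R_def powr_powr using assms by simp
  then have "T \<le> R powr q" by simp
  then have "power_ball k q T \<subseteq> lattice_ball k q R"
    unfolding lattice_ball_eq_power_ball by (rule power_ball_mono)
  moreover have "finite (lattice_ball k q R)"
    using assms by (rule finite_lattice_ball) (simp add: R_def)
  ultimately show ?thesis by (rule finite_subset)
qed

lemma sum_symmetric_int_interval:
  fixes f :: "int \<Rightarrow> real"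
  shows "(\<Sum>z\<in>{- int m..int m}. f z) = f 0 + (\<Sum>a<m. f (int (Suc a)) + f (- int (Suc a)))"
proof (induction m)
  case (Suc m)
  have "{- int (Suc m)..int (Suc m)} = insert (int (Suc m)) (insert (- int (Suc m)) {- int m..int m})"
    by auto
  then have "(\<Sum>z\<in>{- int (Suc m)..int (Suc m)}. f z)
      = f (int (Suc m)) + (f (- int (Suc m)) + (\<Sum>z\<in>{- int m..int m}. f z))"
    by (simp del: of_nat_Suc)
  then show ?case unfolding Suc.IH by simp
qed simp

text \<open>
Each point of the ball has weight \<open>exp (s * (T - \<Sum>\<bar>a\<^sub>i\<bar>\<^sup>q)) \<ge> 1\<close>, and the total weight of a box of lattice
points factorises over the coordinates.
\<close>

lemma card_power_ball_le_partition_function: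
  assumes "1 \<le> q" "0 < s"
  shows "real (card (power_ball k q T)) \<le> exp (s * T) * (1 + 2 * (Gamma (1/q + 1) / s powr (1/q))) ^ k"
proof -
  let ?B = "power_ball k q T" and ?e = "\<lambda>z::int. exp (- (s * \<bar>real_of_int z\<bar> powr q))"
  have fin: "finite ?B" using assms(1) by (rule finite_power_ball)
  have "finite (\<Union>a\<in>?B. (\<lambda>i. nat \<bar>a i\<bar>) ` {..<k})" (is "finite ?N") using fin by auto
  then obtain m where m: "\<And>y. y \<in> ?N \<Longrightarrow> y < m"
    by (metis bounded_nat_set_is_finite finite_nat_set_iff_bounded)
  let ?I = "{- int m..int m}"
  have sub: "?B \<subseteq> {..<k} \<rightarrow>\<^sub>E ?I"
  proof
    fix a assume a: "a \<in> ?B"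
    have "a i \<in> ?I" if "i < k" for i
    proof -
      have "nat \<bar>a i\<bar> < m" using a that by (intro m) blast
      then show ?thesis by auto
    qed
    then show "a \<in> {..<k} \<rightarrow>\<^sub>E ?I"
      using a by (auto simp: power_ball_def PiE_iff)
  qed
  have "(\<Sum>z\<in>?I. ?e z) = 1 + 2 * (\<Sum>a<m. exp (- (s * real (Suc a) powr q)))"
    unfolding sum_symmetric_int_interval by (simp add: sum_distrib_left add.commute)
  then have Z: "(\<Sum>z\<in>?I. ?e z) \<le> 1 + 2 * (Gamma (1/q + 1) / s powr (1/q))"
    using assms sum_exp_minus_powr_le[of q s m] by linarith
  have "real (card ?B) = (\<Sum>a\<in>?B. 1)" by simp
  also have "\<dots> \<le> (\<Sum>a\<in>?B. exp (s * T) * (\<Prod>i<k. ?e (a i)))"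
  proof (rule sum_mono)
    fix a assume "a \<in> ?B"
    then have "0 \<le> s * (T - (\<Sum>i<k. \<bar>real_of_int (a i)\<bar> powr q))"
      using assms by (simp add: power_ball_def)
    also have "\<dots> = s * T + (\<Sum>i<k. - (s * \<bar>real_of_int (a i)\<bar> powr q))"
      by (simp add: algebra_simps sum_distrib_left sum_negf)
    finally show "1 \<le> exp (s * T) * (\<Prod>i<k. ?e (a i))"
      by (simp flip: exp_sum exp_add)
  qed
  also have "\<dots> \<le> (\<Sum>a\<in>{..<k} \<rightarrow>\<^sub>E ?I. exp (s * T) * (\<Prod>i<k. ?e (a i)))"
    using sub by (intro sum_mono2) (auto intro!: finite_PiE mult_nonneg_nonneg prod_nonneg)
  also have "\<dots> = exp (s * T) * (\<Sum>z\<in>?I. ?e z) ^ k"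
    using prod_sum_PiE[of "{..<k}" "\<lambda>_. ?I" "\<lambda>_. ?e"] by (simp add: sum_distrib_left[symmetric])
  also have "\<dots> \<le> exp (s * T) * (1 + 2 * (Gamma (1/q + 1) / s powr (1/q))) ^ k"
    using Z by (intro mult_left_mono power_mono) (auto intro: sum_nonneg)
  finally show ?thesis .
qed

text \<open>
The value of \<open>s\<close> minimises \<open>exp (s R\<^sup>q) * s\<^bsup>-k/q\<^esup>\<close>, the main part of the preceding bound; this choice
produces the factor \<open>(q e)\<^bsup>1/q\<^esup>\<close> of \<open>C_const q\<close>.
\<close>

lemma card_lattice_ball_le:
  assumes "1 \<le> q" "0 < k" "0 < R"
  shows "real (card (lattice_ball k q R)) \<le> (exp (1/q) + C_const q * R / real k powr (1/q)) ^ k"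
proof -
  define s where "s = real k / (q * R powr q)"
  have s: "0 < s" using assms by (simp add: s_def)
  have sT: "s * R powr q = real k * (1/q)" using assms by (simp add: s_def)
  have sq: "s powr (1/q) = real k powr (1/q) / (q powr (1/q) * R)"
    using assms by (simp add: s_def powr_divide powr_mult powr_powr)
  have "real (card (lattice_ball k q R)) \<le>
      exp (s * R powr q) * (1 + 2 * (Gamma (1/q + 1) / s powr (1/q))) ^ k"
    unfolding lattice_ball_eq_power_ball using assms(1) s by (rule card_power_ball_le_partition_function)
  also have "\<dots> = (exp (1/q) * (1 + 2 * (Gamma (1/q + 1) / s powr (1/q)))) ^ k"
    unfolding sT by (simp only: exp_of_nat_mult power_mult_distrib)
  also have "exp (1/q) * (1 + 2 * (Gamma (1/q + 1) / s powr (1/q)))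
      = exp (1/q) + C_const q * R / real k powr (1/q)"
    using assms unfolding sq C_const_def by (simp add: algebra_simps powr_mult exp_powr_real)
  finally show ?thesis .
qed

section \<open>Lower bound for the number of lattice points\<close>

text \<open>
Convexity of \<open>x\<^sup>q\<close>, applied to \<open>x + 1 = (1 - d) * (x / (1 - d)) + d * (1 / d)\<close>.  Summed over coordinates and
optimised over \<open>d\<close>, it amounts to the triangle inequality of the \<open>q\<close>-norm for adding \<open>1\<close> to each
coordinate; in this form it can be used one coordinate at a time.
\<close>

lemma powr_add_one_le:
  fixes q d x :: real
  assumes "1 \<le> q" "0 < d" "d < 1" "0 \<le> x"
  shows "(x + 1) powr q \<le> x powr q / (1 - d) powr (q - 1) + d powr (1 - q)"
proof (cases "x = 0")
  case True
  then show ?thesis using assms powr_mono2'[of "1 - q" d 1] by simp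
next
  case False
  have "((1 - d) *\<^sub>R (x / (1 - d)) + d *\<^sub>R (1 / d)) powr q
      \<le> (1 - d) * (x / (1 - d)) powr q + d * (1 / d) powr q"
    using False assms by (intro convex_onD[OF powr_convex]) auto
  moreover have "d * (1 / d) powr q = d powr (1 - q)"
    using assms by (simp add: powr_divide powr_diff)
  moreover have "(1 - d) * (x / (1 - d)) powr q = x powr q / (1 - d) powr (q - 1)"
    using assms by (simp add: powr_divide powr_diff)
  ultimately show ?thesis using assms by simp
qed

text \<open>
Slicing along the last coordinate.  The slice at height \<open>0\<close> is dropped, because the others
form two equal families, indexed by the integers from \<open>1\<close> on, where rounding up a real height
lands.
\<close>

lemma card_power_ball_Suc_ge:
  assumes "1 \<le> q"
  shows "2 * (\<Sum>a<m. card (power_ball k q (T - real (Suc a) powr q))) \<le> card (power_ball (Suc k) q T)"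
proof -
  let ?P = "(\<lambda>a. int (Suc a)) ` {..<m}" and ?N = "(\<lambda>a. - int (Suc a)) ` {..<m}"
  let ?c = "\<lambda>z::int. card (power_ball k q (T - \<bar>real_of_int z\<bar> powr q))"
  let ?S = "SIGMA z:?P \<union> ?N. power_ball k q (T - \<bar>real_of_int z\<bar> powr q)"
  let ?F = "\<lambda>(z::int, f). f(k := z)"
  have "2 * (\<Sum>a<m. card (power_ball k q (T - real (Suc a) powr q)))
      = (\<Sum>a<m. ?c (int (Suc a))) + (\<Sum>a<m. ?c (- int (Suc a)))"
    by (simp add: add.commute)
  also have "\<dots> = (\<Sum>z\<in>?P. ?c z) + (\<Sum>z\<in>?N. ?c z)"
    by (simp add: sum.reindex inj_on_def)
  also have "\<dots> = (\<Sum>z\<in>?P \<union> ?N. ?c z)"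
    by (rule sum.union_disjoint[symmetric]) auto
  also have "\<dots> = card ?S"
    using assms by (intro card_SigmaI[symmetric]) (simp_all add: finite_power_ball)
  also have "\<dots> = card (?F ` ?S)"
  proof (rule card_image[symmetric])
    have "inj_on ?F (UNIV \<times> ({..<k} \<rightarrow>\<^sub>E UNIV))"
      using inj_combinator[of k "{..<k}" "\<lambda>_. UNIV"] by simp
    then show "inj_on ?F ?S"
      by (rule inj_on_subset) (auto simp: power_ball_def)
  qed
  also have "\<dots> \<le> card (power_ball (Suc k) q T)"
  proof (intro card_mono finite_power_ball assms subsetI)
    fix g assume "g \<in> ?F ` ?S"
    then obtain p where p: "p \<in> ?S" "g = ?F p" by (rule imageE) simp
    obtain z f where "p = (z, f)" by (cases p)
    with p have g: "g = f(k := z)" and f: "f \<in> power_ball k q (T - \<bar>real_of_int z\<bar> powr q)"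
      by (simp_all only: mem_Sigma_iff prod.case)
    have "f(k := z) \<in> {..<Suc k} \<rightarrow>\<^sub>E UNIV"
      using f by (auto simp: power_ball_def PiE_iff extensional_def)
    moreover have "(\<Sum>i<k. \<bar>real_of_int ((f(k := z)) i)\<bar> powr q) = (\<Sum>i<k. \<bar>real_of_int (f i)\<bar> powr q)"
      by (intro sum.cong) auto
    ultimately show "g \<in> power_ball (Suc k) q T"
      using f unfolding g by (simp add: power_ball_def)
  qed
  finally show ?thesis .
qed

text \<open>
With \<open>S = (T - k * \<beta>) * \<alpha>\<close> the bound is the volume of the ball \<open>{\<Sum>\<bar>x\<^sub>i\<bar>\<^sup>q \<le> S}\<close>.  The hypothesis
\<open>shift\<close> makes the induction work: for a slice at integer height \<open>a + 1\<close> and every \<open>x\<close> in \<open>[a, a + 1]\<close>,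
the bound \<open>T - (a + 1)\<^sup>q - k * \<beta>\<close>, scaled by \<open>\<alpha>\<close>, is at least \<open>(T - (k + 1) * \<beta>) * \<alpha> - x\<^sup>q\<close>, so each slice
dominates the integral of the volumes of the real slices over \<open>[a, a + 1]\<close>.  The truncation by \<open>max 0\<close>
extends the integrand by \<open>0\<close>, also in dimension \<open>0\<close>, where \<open>0 powr 0 = 0\<close>.
\<close>

lemma card_power_ball_ge:
  fixes q \<alpha> \<beta> :: real
  assumes "1 \<le> q" "0 < \<alpha>" "0 \<le> \<beta>"
    and shift: "\<And>x. 0 \<le> x \<Longrightarrow> (x + 1) powr q \<le> x powr q / \<alpha> + \<beta>"
  shows "(2 * Gamma (1/q + 1)) ^ k / Gamma (real k / q + 1) * max 0 ((T - real k * \<beta>) * \<alpha>) powr (real k / q)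
      \<le> real (card (power_ball k q T))"
proof (induction k arbitrary: T)
  case 0
  show ?case
  proof (cases "0 < T")
    case True
    then have "power_ball 0 q T = {\<lambda>_. undefined}" by (auto simp: power_ball_def)
    then show ?thesis by simp
  next
    case False
    then have "T * \<alpha> \<le> 0" using assms(2) by (simp add: mult_nonpos_nonneg)
    then show ?thesis by simp
  qed
next
  case (Suc k)
  define S where "S = (T - real (Suc k) * \<beta>) * \<alpha>"
  define G where "G = Gamma (1/q + 1)"
  define r where "r = real k / q"
  have r: "0 \<le> r" "r + 1/q = real (Suc k) / q" using assms(1) by (auto simp: r_def field_simps)
  have pos: "0 < G" "0 < Gamma (r + 1)" using assms(1) r by (auto simp: G_def intro!: Gamma_real_pos add_nonneg_pos)
  show ?case
  proof (cases "0 < S")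
    case True
    obtain m where m: "S powr (1/q) \<le> real m" using real_arch_simple by blast
    let ?g = "\<lambda>x. (2 * G) ^ k / Gamma (r + 1) * max 0 (S - x powr q) powr r"
    have "((\<lambda>x. max 0 (S - x powr q) powr r) has_integral
             G * Gamma (r + 1) / Gamma (r + 1 + 1/q) * S powr (r + 1/q)) {0..real m}"
      unfolding G_def using assms(1) r True m by (intro has_integral_powr_section) auto
    from has_integral_mult_right[OF this, of "(2 * G) ^ k / Gamma (r + 1)"]
    have int: "(?g has_integral (2 * G) ^ k * G / Gamma (real (Suc k) / q + 1) * S powr (real (Suc k) / q)) {0..real m}"
      using pos r(2) by (simp add: add_ac mult_ac)
    have "integral {0..real m} ?g \<le> (\<Sum>a<m. real (card (power_ball k q (T - real (Suc a) powr q))))"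
    proof (rule integral_le_sum_of_upper_bounds)
      show "?g integrable_on {0..real m}" using int by blast
    next
      fix a x assume ax: "a < m" "real a \<le> x" "x \<le> real a + 1"
      have "real (Suc a) powr q \<le> (x + 1) powr q"
        using ax assms(1) by (intro powr_mono2) auto
      also have "\<dots> \<le> x powr q / \<alpha> + \<beta>"
        using ax by (intro shift) auto
      finally have "(T - real (Suc k) * \<beta> - x powr q / \<alpha>) * \<alpha> \<le> (T - real (Suc a) powr q - real k * \<beta>) * \<alpha>"
        using assms(2) by (intro mult_right_mono) (auto simp: algebra_simps)
      moreover have "(T - real (Suc k) * \<beta> - x powr q / \<alpha>) * \<alpha> = S - x powr q"
        using assms(2) by (simp add: S_def algebra_simps)
      ultimately have "max 0 (S - x powr q) powr r \<le> max 0 ((T - real (Suc a) powr q - real k * \<beta>) * \<alpha>) powr r"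
        using r by (intro powr_mono2) auto
      then have "?g x \<le> (2 * G) ^ k / Gamma (r + 1) * max 0 ((T - real (Suc a) powr q - real k * \<beta>) * \<alpha>) powr r"
        using pos by (intro mult_left_mono) auto
      also have "\<dots> \<le> real (card (power_ball k q (T - real (Suc a) powr q)))"
        unfolding G_def r_def by (rule Suc.IH)
      finally show "?g x \<le> real (card (power_ball k q (T - real (Suc a) powr q)))" .
    qed
    moreover have "2 * (\<Sum>a<m. real (card (power_ball k q (T - real (Suc a) powr q)))) \<le> real (card (power_ball (Suc k) q T))"
      using card_power_ball_Suc_ge[OF assms(1), where m = m and k = k and T = T] by (simp flip: of_nat_sum)
    ultimately have "2 * ((2 * G) ^ k * G / Gamma (real (Suc k) / q + 1) * S powr (real (Suc k) / q))
        \<le> real (card (power_ball (Suc k) q T))"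
      using integral_unique[OF int] by linarith
    then show ?thesis using True by (simp add: S_def G_def mult_ac)
  qed (auto simp: S_def)
qed

text \<open>
The parameter \<open>d = k\<^bsup>1/q\<^esup> / R\<close> is the optimal one in \<open>powr_add_one_le\<close>: then \<open>S = (R - k\<^bsup>1/q\<^esup>)\<^sup>q\<close> in the
preceding lemma.
\<close>

lemma card_lattice_ball_ge:
  assumes "1 \<le> q" "0 < k" "real k powr (1/q) < R"
  shows "(2 * Gamma (1/q + 1)) ^ k / Gamma (real k / q + 1) * (R - real k powr (1/q)) ^ k
      \<le> real (card (lattice_ball k q R))"
proof -
  define d where "d = real k powr (1/q) / R"
  have R: "0 < R" using assms(3) powr_ge_zero[of "real k" "1/q"] by linarith
  have d: "0 < d" "d < 1" using assms R by (auto simp: d_def)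
  have "real k * d powr (1 - q) = d * R powr q"
  proof -
    have "d powr q = real k / R powr q"
      using assms R by (simp add: d_def powr_divide powr_powr)
    moreover have "d powr (1 - q) = d / d powr q"
      using d by (simp add: powr_diff)
    ultimately show ?thesis using assms(2) by simp
  qed
  then have "R powr q - real k * d powr (1 - q) = R powr q * (1 - d)"
    by (simp add: algebra_simps)
  then have "(R powr q - real k * d powr (1 - q)) * (1 - d) powr (q - 1) = R powr q * ((1 - d) * (1 - d) powr (q - 1))"
    by (metis mult.assoc)
  also have "\<dots> = R powr q * (1 - d) powr q"
    using d by (simp add: powr_mult_base)
  also have "\<dots> = (R * (1 - d)) powr q"
    using d R by (simp add: powr_mult)
  also have "R * (1 - d) = R - real k powr (1/q)"
    using R by (simp add: d_def right_diff_distrib)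
  finally have eq: "(R powr q - real k * d powr (1 - q)) * (1 - d) powr (q - 1) = (R - real k powr (1/q)) powr q" .
  define D where "D = R - real k powr (1/q)"
  have "0 < D" using assms by (simp add: D_def)
  then have pow: "max 0 (D powr q) powr (real k / q) = D ^ k"
    using assms(1) by (simp add: powr_powr powr_realpow)
  have "(2 * Gamma (1/q + 1)) ^ k / Gamma (real k / q + 1) *
      max 0 ((R powr q - real k * d powr (1 - q)) * (1 - d) powr (q - 1)) powr (real k / q)
      \<le> real (card (power_ball k q (R powr q)))"
    using assms(1) d by (intro card_power_ball_ge powr_add_one_le) auto
  then show ?thesis
    unfolding eq lattice_ball_eq_power_ball pow[unfolded D_def] .
qed

section \<open>A crude Stirling bound\<close>

text \<open>
The quotient of the two sides does not increase under \<open>y \<mapsto> y + 1\<close>, because \<open>(1 + 1/y)\<^bsup>y + 1\<^esup> \<ge> e\<close>, so it is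
bounded by its maximum on the interval \<open>[1, 2]\<close>.  Compared with Stirling's formula a factor of order
\<open>sqrt y\<close> is lost.
\<close>

lemma Gamma_plus1_le_powr:
  obtains c :: real where "0 < c" "\<And>y::real. 1 \<le> y \<Longrightarrow> Gamma (y + 1) \<le> c * (y powr (y + 1) * exp (- y))"
proof -
  define h where "h = (\<lambda>y::real. Gamma (y + 1) * exp y / y powr (y + 1))"
  have step: "h (y + 1) \<le> h y" if "0 < y" for y
  proof -
    have "ln (y / (y + 1)) \<le> y / (y + 1) - 1"
      using that by (intro ln_le_minus_one) auto
    then have "(y + 1) * ln (y / (y + 1)) \<le> (y + 1) * (y / (y + 1) - 1)"
      using that by (intro mult_left_mono) auto
    also have "\<dots> = -1"
      using that by (simp add: field_simps)
    finally have "1 + (y + 1) * ln y \<le> (y + 1) * ln (y + 1)"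
      using that by (simp add: ln_div algebra_simps)
    then have "exp 1 * y powr (y + 1) \<le> (y + 1) powr (y + 1)"
      using that by (simp add: powr_def flip: exp_add)
    then have "exp 1 / (y + 1) powr (y + 1) \<le> 1 / y powr (y + 1)"
      using that by (simp add: field_simps)
    then have *: "Gamma (y + 1) * exp y * (exp 1 / (y + 1) powr (y + 1))
        \<le> Gamma (y + 1) * exp y * (1 / y powr (y + 1))"
      using that by (intro mult_left_mono mult_nonneg_nonneg) (auto intro: less_imp_le Gamma_real_pos)
    have "Gamma (y + 1 + 1) = (y + 1) * Gamma (y + 1)"
      using that by (intro Gamma_plus1_pos) auto
    moreover have "(y + 1) powr (y + 1 + 1) = (y + 1) * (y + 1) powr (y + 1)"
      using that by (subst powr_add) simp
    ultimately have "h (y + 1) = Gamma (y + 1) * exp y * (exp 1 / (y + 1) powr (y + 1))"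
      using that by (simp add: h_def exp_add)
    with * show ?thesis by (simp add: h_def)
  qed
  have "continuous_on {1..2} h"
  proof -
    have "continuous_on {1..2} (\<lambda>y::real. Gamma (y + 1))"
      by (rule continuous_on_compose2[OF continuous_on_Gamma[of "{2..3}"]])
         (auto elim!: nonpos_Ints_cases intro!: continuous_intros)
    then show ?thesis
      unfolding h_def by (intro continuous_intros) auto
  qed
  then have "\<exists>x\<in>{1..2}. \<forall>y\<in>{1..2}. h y \<le> h x"
    by (intro continuous_attains_sup) auto
  then obtain c where c: "\<And>y. y \<in> {1..2} \<Longrightarrow> h y \<le> c" by blast
  have bound: "h y \<le> c" if "1 \<le> y" "y \<le> real n + 2" for y n
    using that
  proof (induction n arbitrary: y)
    case (Suc n)
    show ?case
    proof (cases "y \<le> 2")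
      case False
      then have "h y \<le> h (y - 1)" using step[of "y - 1"] by simp
      also have "\<dots> \<le> c" using False Suc.prems by (intro Suc.IH) auto
      finally show ?thesis .
    qed (use c Suc.prems in auto)
  qed (use c in auto)
  have "0 < h 1" by (simp add: h_def Gamma_real_pos)
  then have "0 < c" using c[of 1] by simp
  moreover have "Gamma (y + 1) \<le> c * (y powr (y + 1) * exp (- y))" if "1 \<le> y" for y
  proof -
    obtain n where "y \<le> real n" using real_arch_simple by blast
    then have "h y \<le> c" using that by (intro bound[of y n]) auto
    then show ?thesis using that by (simp add: h_def field_simps exp_minus)
  qed
  ultimately show ?thesis by (rule that)
qed

section \<open>Counting at perturbed critical radii\<close>

lemma C_const_pos: "0 < q \<Longrightarrow> 0 < C_const q"
  unfolding C_const_def by (intro mult_pos_pos) (auto intro!: Gamma_real_pos add_pos_pos)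

lemma powr_inverse_power:
  assumes "0 < k" "0 < n"
  shows "(real n powr (1 / real k)) ^ k = real n"
  using assms by (simp add: powr_powr flip: powr_realpow)

text \<open>
At radius \<open>M e\<^bsup>-u\<^esup>\<close> the upper bound reads \<open>(e\<^bsup>1/q\<^esup> + L e\<^bsup>-u\<^esup>)\<^sup>k = n e\<^bsup>-k u\<^esup> (1 + e\<^bsup>u + 1/q\<^esup> / L)\<^sup>k\<close>; the constant
\<open>9\<close> bounds \<open>e\<^sup>2\<close>.
\<close>

lemma card_lattice_ball_inner_le:
  fixes u :: real
  assumes "1 \<le> q" "0 < k" "0 < n" "u \<le> 1"
  shows "real (card (lattice_ball k q (frakM n k q * exp (- u))))
      \<le> real n * exp (9 * (real k / real n powr (1 / real k)) - real k * u)"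
proof -
  define L where "L = real n powr (1 / real k)"
  have L: "0 < L" using assms by (simp add: L_def)
  have C: "0 < C_const q" using assms by (intro C_const_pos) auto
  define R where "R = frakM n k q * exp (- u)"
  have "0 < R" using C L assms by (simp add: R_def frakM_def)
  then have "real (card (lattice_ball k q R)) \<le> (exp (1/q) + C_const q * R / real k powr (1/q)) ^ k"
    using assms by (intro card_lattice_ball_le) auto
  also have "C_const q * R / real k powr (1/q) = L * exp (- u)"
    using C assms by (simp add: R_def frakM_def L_def)
  also have "exp (1/q) + L * exp (- u) = L * (exp (- u) * (1 + exp (u + 1/q) / L))"
  proof -
    have "exp (- u) * exp (u + 1/q) = exp (1/q)"
      by (simp flip: exp_add)
    then show ?thesis using L by (simp add: algebra_simps)
  qed
  also have "(L * (exp (- u) * (1 + exp (u + 1/q) / L))) ^ k \<le> (L * (exp (- u) * exp (9 / L))) ^ k"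
  proof (intro power_mono mult_left_mono)
    have "exp (u + 1/q) \<le> exp (1 + 1)"
      unfolding exp_le_cancel_iff using assms by (intro add_mono) auto
    also have "\<dots> = exp 1 * exp (1::real)" by (rule exp_add)
    also have "\<dots> \<le> 3 * 3" by (intro mult_mono exp_le) auto
    finally have "1 + exp (u + 1/q) / L \<le> 1 + 9 / L"
      using L by (simp add: divide_right_mono)
    also have "\<dots> \<le> exp (9 / L)" by (rule exp_ge_add_one_self)
    finally show "1 + exp (u + 1/q) / L \<le> exp (9 / L)" .
  qed (use L in \<open>auto intro!: mult_nonneg_nonneg add_nonneg_nonneg\<close>)
  also have "\<dots> = L ^ k * exp (real k * (9 / L - u))"
  proof -
    have "exp (9 / L - u) = exp (- u) * exp (9 / L)" by (simp flip: exp_add)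
    then show ?thesis by (simp only: exp_of_nat_mult power_mult_distrib)
  qed
  also have "L ^ k = real n" unfolding L_def using assms by (intro powr_inverse_power)
  also have "real k * (9 / L - u) = 9 * (real k / L) - real k * u"
    by (simp add: algebra_simps)
  finally show ?thesis by (simp only: R_def L_def)
qed

text \<open>
Rounding the radius down costs at most \<open>1 \<le> k\<^bsup>1/q\<^esup>\<close>, so that together with the loss in
\<open>card_lattice_ball_ge\<close> the radius drops by at most \<open>2 k\<^bsup>1/q\<^esup> = M * (2 C / L)\<close>.  The prefactor is what the
Stirling bound leaves of \<open>\<Gamma>(k/q + 1)\<close> after \<open>(k / (q e))\<^bsup>k/q\<^esup>\<close> has cancelled.
\<close>

lemma card_lattice_ball_floor_ge:
  assumes "1 \<le> q" "q \<le> real k" "0 < n"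
    and c: "0 < c" "\<And>y::real. 1 \<le> y \<Longrightarrow> Gamma (y + 1) \<le> c * (y powr (y + 1) * exp (- y))"
    and v: "2 * C_const q / real n powr (1 / real k) < 1 + v"
  shows "q / (c * real k) * (real n * (1 + v - 2 * C_const q / real n powr (1 / real k)) ^ k)
      \<le> real (card (lattice_ball k q (real (nat \<lfloor>frakM n k q * (1 + v)\<rfloor>))))"
proof -
  define L where "L = real n powr (1 / real k)"
  define P where "P = real k powr (1/q)"
  define C where "C = C_const q"
  define D where "D = 1 + v - 2 * C / L"
  define R where "R = real (nat \<lfloor>frakM n k q * (1 + v)\<rfloor>)"
  define y where "y = real k / q"
  have k: "0 < k" using assms by (cases k) auto
  have L: "0 < L" using assms by (simp add: L_def)
  have C: "0 < C" unfolding C_def using assms by (intro C_const_pos) auto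
  have P: "1 \<le> P" unfolding P_def using k assms by (intro ge_one_powr_ge_zero) auto
  have D: "0 < D" using v by (simp add: D_def C_def L_def)
  have y: "1 \<le> y" using assms by (simp add: y_def)
  have M: "frakM n k q = P * L / C" by (simp add: frakM_def P_def L_def C_def)
  have "P / C * (L * D) = frakM n k q * (1 + v) - 2 * P"
    using C L by (simp add: M D_def field_simps)
  also have "\<dots> \<le> R - P"
    unfolding R_def using P by linarith
  finally have RP: "P / C * (L * D) \<le> R - P" .
  have PLD: "0 < P / C * (L * D)" using P C L D by simp
  have "(2 * Gamma (1/q + 1)) ^ k * (P / C) ^ k = y powr y * exp (- y)"
  proof -
    have "Gamma (1/q + 1) > 0" using assms by (intro Gamma_real_pos) (auto intro: add_pos_pos)
    then have "2 * Gamma (1/q + 1) * (P / C) = P / (q * exp 1) powr (1/q)"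
      unfolding C_def C_const_def by simp
    also have "\<dots> = (y * exp (- 1)) powr (1/q)"
      using assms unfolding P_def y_def by (simp add: powr_divide[symmetric] exp_minus field_simps)
    finally have "(2 * Gamma (1/q + 1)) ^ k * (P / C) ^ k = ((y * exp (- 1)) powr (1/q)) ^ k"
      by (simp only: power_mult_distrib[symmetric])
    also have "\<dots> = (y * exp (- 1)) powr y"
      by (subst powr_power) (use y k in \<open>auto simp: y_def\<close>)
    also have "\<dots> = y powr y * exp (- y)"
      using y by (simp add: powr_mult exp_powr_real)
    finally show ?thesis .
  qed
  moreover have "q / (c * real k) \<le> y powr y * exp (- y) / Gamma (y + 1)"
  proof -
    have "q / (c * real k) * Gamma (y + 1) \<le> q / (c * real k) * (c * (y powr (y + 1) * exp (- y)))"
      using assms y by (intro mult_left_mono) auto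
    also have "\<dots> = y powr y * exp (- y)"
      using assms k y by (simp add: powr_add y_def)
    finally show ?thesis
      using y by (simp add: pos_le_divide_eq Gamma_real_pos)
  qed
  ultimately have "q / (c * real k) \<le> (2 * Gamma (1/q + 1)) ^ k / Gamma (y + 1) * (P / C) ^ k"
    by simp
  then have "q / (c * real k) * (L * D) ^ k \<le> (2 * Gamma (1/q + 1)) ^ k / Gamma (y + 1) * (P / C) ^ k * (L * D) ^ k"
    using L D by (intro mult_right_mono) auto
  also have "\<dots> = (2 * Gamma (1/q + 1)) ^ k / Gamma (y + 1) * (P / C * (L * D)) ^ k"
    by (simp only: power_mult_distrib mult.assoc)
  also have "\<dots> \<le> (2 * Gamma (1/q + 1)) ^ k / Gamma (y + 1) * (R - P) ^ k"
    using RP PLD assms y by (intro mult_left_mono power_mono divide_nonneg_nonneg zero_le_power)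
      (auto intro!: less_imp_le[OF Gamma_real_pos] add_nonneg_pos)
  also have "\<dots> \<le> real (card (lattice_ball k q R))"
    unfolding y_def P_def using assms k RP PLD by (intro card_lattice_ball_ge) (auto simp: P_def)
  also have "(L * D) ^ k = real n * D ^ k"
    unfolding L_def using assms k by (simp add: power_mult_distrib powr_inverse_power)
  finally show ?thesis by (simp only: R_def D_def C_def L_def)
qed

section \<open>Asymptotics\<close>

lemma omega_ge: "(ln (real k))\<^sup>2 \<le> omega n k" "real k / real n powr (1 / (2 * real k)) \<le> omega n k"
  by (simp_all add: omega_def)

lemma powr_half_inverse: "real n powr (1 / (2 * real k)) = sqrt (real n powr (1 / real k))"
  by (simp add: powr_half_sqrt[symmetric] powr_powr mult.commute)

lemma quotient_le_omega:
  assumes "1 \<le> n"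
  shows "real k / real n powr (1 / real k) \<le> omega n k"
proof -
  have "1 \<le> real n powr (1 / real k)"
    using assms by (intro ge_one_powr_ge_zero) auto
  then have "sqrt (real n powr (1 / real k)) \<le> real n powr (1 / real k)"
    by (intro real_le_lsqrt) (auto simp: self_le_power)
  then have "real k / real n powr (1 / real k) \<le> real k / real n powr (1 / (2 * real k))"
    using assms unfolding powr_half_inverse by (intro divide_left_mono) auto
  then show ?thesis using omega_ge(2) by (rule order_trans)
qed

context
  fixes k :: "nat \<Rightarrow> nat"
  assumes unbounded: "(\<lambda>n. 1) \<in> o(\<lambda>n. real (k n))"
    and sublog: "\<forall>\<^sub>F n in sequentially. real (k n) \<le> ln (real n) / ln (ln (real n))"
begin

lemma dimension_at_top: "filterlim k at_top sequentially"
proof -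
  have "filterlim (\<lambda>n. real (k n)) at_top sequentially"
    unfolding filterlim_at_top_gt[where c = 0]
  proof safe
    fix Z :: real assume "0 < Z"
    then have "\<forall>\<^sub>F n in sequentially. norm (1::real) \<le> 1 / Z * norm (real (k n))"
      using landau_o.smallD[OF unbounded, of "1 / Z"] by simp
    then show "\<forall>\<^sub>F n in sequentially. Z \<le> real (k n)"
      by eventually_elim (use \<open>0 < Z\<close> in \<open>simp add: field_simps\<close>)
  qed
  then show ?thesis
    unfolding filterlim_sequentially_iff_filterlim_real by simp
qed

lemma ln_dimension_at_top: "filterlim (\<lambda>n. ln (real (k n))) at_top sequentially"
  by (rule filterlim_compose[OF ln_at_top])
     (rule filterlim_compose[OF filterlim_real_sequentially dimension_at_top])

text \<open>
The hypothesis \<open>k \<le> ln n / ln (ln n)\<close> says that \<open>n\<^bsup>1/k\<^esup> \<ge> ln n\<close>, once \<open>ln (ln n) > 0\<close>.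
\<close>

lemma scale_at_top: "filterlim (\<lambda>n. real n powr (1 / real (k n))) at_top sequentially"
proof (rule filterlim_at_top_mono)
  show lnn: "filterlim (\<lambda>n. ln (real n)) at_top sequentially"
    by (rule filterlim_compose[OF ln_at_top filterlim_real_sequentially])
  have "\<forall>\<^sub>F n in sequentially. exp 1 \<le> ln (real n)"
    using lnn by (simp add: filterlim_at_top)
  moreover have "\<forall>\<^sub>F n in sequentially. 1 \<le> k n"
    using dimension_at_top by (simp add: filterlim_at_top)
  ultimately show "\<forall>\<^sub>F n in sequentially. ln (real n) \<le> real n powr (1 / real (k n))"
    using sublog
  proof eventually_elim
    case (elim n)
    have l: "0 < ln (real n)" using elim(1) exp_gt_zero[of "1::real"] by linarith
    then have "1 \<le> ln (ln (real n))" using elim(1) by (simp add: ln_ge_iff)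
    then have "ln (ln (real n)) * real (k n) \<le> ln (real n)"
      using elim(3) by (simp add: pos_le_divide_eq mult.commute)
    then have "ln (ln (real n)) \<le> ln (real n) / real (k n)"
      using elim(2) by (simp add: pos_le_divide_eq)
    then have "exp (ln (ln (real n))) \<le> exp (1 / real (k n) * ln (real n))"
      by simp
    moreover have "n \<noteq> 0" using l by (cases n) auto
    ultimately show ?case using l by (simp add: powr_def)
  qed
qed

lemma omega_at_top: "filterlim (\<lambda>n. omega n (k n)) at_top sequentially"
proof (rule filterlim_at_top_mono)
  show "filterlim (\<lambda>n. (ln (real (k n)))\<^sup>2) at_top sequentially"
    by (intro filterlim_pow_at_top ln_dimension_at_top) auto
qed (simp add: omega_ge)

lemma omega_over_dimension: "(\<lambda>n. omega n (k n) / real (k n)) \<longlonglongrightarrow> 0"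
proof -
  have "(\<lambda>m. (ln (real m) / real m powr (1/2))\<^sup>2) \<longlonglongrightarrow> 0\<^sup>2"
    by (intro tendsto_power lim_ln_over_power) auto
  then have "(\<lambda>m. (ln (real m))\<^sup>2 / real m) \<longlonglongrightarrow> 0"
    by (simp add: power_divide powr_half_sqrt)
  then have 1: "(\<lambda>n. (ln (real (k n)))\<^sup>2 / real (k n)) \<longlonglongrightarrow> 0"
    by (rule filterlim_compose[OF _ dimension_at_top])
  have "filterlim (\<lambda>n. real n powr (1 / (2 * real (k n)))) at_top sequentially"
    unfolding powr_half_inverse by (rule filterlim_compose[OF sqrt_at_top scale_at_top])
  then have 2: "(\<lambda>n. inverse (real n powr (1 / (2 * real (k n))))) \<longlonglongrightarrow> 0"
    by (rule tendsto_inverse_0_at_top)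
  have "(\<lambda>n. max ((ln (real (k n)))\<^sup>2 / real (k n)) (inverse (real n powr (1 / (2 * real (k n)))))) \<longlonglongrightarrow> max 0 0"
    using 1 2 by (rule tendsto_max)
  moreover have "\<forall>\<^sub>F n in sequentially. 1 \<le> k n"
    using dimension_at_top by (simp add: filterlim_at_top)
  then have "\<forall>\<^sub>F n in sequentially.
      max ((ln (real (k n)))\<^sup>2 / real (k n)) (inverse (real n powr (1 / (2 * real (k n)))))
      = omega n (k n) / real (k n)"
  proof eventually_elim
    case (elim n)
    then show ?case
      by (simp add: omega_def max_divide_distrib_right field_simps)
  qed
  ultimately show ?thesis
    by (simp add: tendsto_cong)
qed

text \<open>
Since \<open>\<omega> \<ge> (ln k)\<^sup>2\<close>, the exponential \<open>e\<^sup>\<omega>\<close> exceeds every fixed power of \<open>k\<close>.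
\<close>

lemma eventually_linear_le_exp_omega:
  assumes "0 < c"
  shows "\<forall>\<^sub>F n in sequentially. c * real (k n) \<le> exp (omega n (k n))"
proof -
  have "\<forall>\<^sub>F n in sequentially. 1 + \<bar>ln c\<bar> \<le> ln (real (k n))"
    using ln_dimension_at_top by (simp add: filterlim_at_top)
  moreover have "\<forall>\<^sub>F n in sequentially. 1 \<le> k n"
    using dimension_at_top by (simp add: filterlim_at_top)
  ultimately show ?thesis
  proof eventually_elim
    case (elim n)
    let ?l = "ln (real (k n))"
    have "ln c + ?l \<le> \<bar>ln c\<bar> * ?l + ?l"
      using elim mult_left_mono[of 1 ?l "\<bar>ln c\<bar>"] by linarith
    also have "\<dots> = (1 + \<bar>ln c\<bar>) * ?l" by (simp add: algebra_simps)
    also have "\<dots> \<le> ?l * ?l" using elim by (intro mult_right_mono) auto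
    also have "\<dots> \<le> omega n (k n)" using omega_ge(1) by (simp add: power2_eq_square)
    finally have "exp (ln c + ?l) \<le> exp (omega n (k n))" by simp
    then show ?case using assms elim by (simp add: exp_add)
  qed
qed

text \<open>
With \<open>t = \<omega>/k\<close> one has \<open>\<xi> \<ge> K t / 2\<close> and \<open>2 C / L \<le> 2 C t\<close>, so the condition on \<open>K\<close> leaves the base of
the \<open>k\<close>-th power at least \<open>1 + 5 t \<ge> e\<^bsup>2 t\<^esup>\<close>.  This gives \<open>e\<^bsup>2 \<omega>\<^esup>\<close>: one factor \<open>e\<^sup>\<omega>\<close> is the gain that is
asked for, the other one pays for the loss linear in \<open>k\<close>.
\<close>

lemma min_radius_le_eventually:
  assumes "1 \<le> q" "10 + 4 * C_const q \<le> K"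
  shows "\<forall>\<^sub>F n in sequentially. int (min_radius n (k n) q) \<le> \<lfloor>frakM n (k n) q * (1 + xi K n (k n))\<rfloor>"
proof -
  define C where "C = C_const q"
  have C: "0 < C" unfolding C_def using assms by (intro C_const_pos) auto
  have K: "0 < K" "10 + 4 * C \<le> K" using assms(2) C by (auto simp: C_def)
  obtain c :: real where c: "0 < c" "\<And>y::real. 1 \<le> y \<Longrightarrow> Gamma (y + 1) \<le> c * (y powr (y + 1) * exp (- y))"
    using Gamma_plus1_le_powr by blast
  have "\<forall>\<^sub>F n in sequentially. omega n (k n) / real (k n) < 1 / K"
    using omega_over_dimension K by (intro order_tendstoD) auto
  moreover have "\<forall>\<^sub>F n in sequentially. nat \<lceil>q\<rceil> \<le> k n"
    using dimension_at_top unfolding filterlim_at_top by blast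
  moreover have "\<forall>\<^sub>F n in sequentially. c / q * real (k n) \<le> exp (omega n (k n))"
    using c assms by (intro eventually_linear_le_exp_omega) auto
  moreover have "\<forall>\<^sub>F n in sequentially. 1 \<le> n"
    by (rule eventually_ge_at_top)
  ultimately show ?thesis
  proof eventually_elim
    case (elim n)
    define w where "w = omega n (k n)"
    define t where "t = w / real (k n)"
    define L where "L = real n powr (1 / real (k n))"
    define R where "R = nat \<lfloor>frakM n (k n) q * (1 + xi K n (k n))\<rfloor>"
    have qk: "q \<le> real (k n)" using elim(2) by simp
    have k: "0 < k n" using qk assms(1) by (cases "k n") auto
    have t0: "0 \<le> t" unfolding t_def w_def using omega_ge(1)[of "k n" n] by (meson divide_nonneg_nonneg of_nat_0_le_iff order_trans zero_le_power2)
    have Kt: "K * t < 1" using elim(1) K by (simp add: t_def w_def field_simps)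
    have "10 * t \<le> K * t" using K C t0 by (intro mult_right_mono) auto
    then have t: "10 * t < 1" using Kt by linarith
    have "1 / L \<le> t"
      using quotient_le_omega[OF elim(4), of "k n"] k by (simp add: t_def w_def L_def field_simps)
    then have CL: "2 * C / L \<le> 2 * C * t" using C mult_left_mono[of "1 / L" t "2 * C"] by simp
    have "xi K n (k n) = 1 - exp (- (K * t))"
      by (simp add: xi_def t_def w_def)
    moreover have "exp (- (K * t)) \<le> 1 - K * t / 2"
    proof -
      have "K * t * (K * t) \<le> K * t * 1" using K t0 Kt by (intro mult_left_mono) auto
      then have "1 \<le> (1 - K * t / 2) * (1 + K * t)" by (simp add: algebra_simps)
      also have "\<dots> \<le> (1 - K * t / 2) * exp (K * t)"
        using Kt by (intro mult_left_mono exp_ge_add_one_self) auto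
      finally show ?thesis by (simp add: exp_minus field_simps)
    qed
    ultimately have xi: "K * t / 2 \<le> xi K n (k n)" by linarith
    have "(10 + 4 * C) * t \<le> K * t" using K t0 by (intro mult_right_mono) auto
    then have "1 + 5 * t \<le> 1 + xi K n (k n) - 2 * C / L"
      using xi CL by (simp add: algebra_simps)
    moreover have "exp (2 * t) \<le> 1 + 5 * t"
    proof -
      have "exp (2 * t) \<le> 1 + 2 * t + (2 * t)\<^sup>2"
        using t t0 by (intro exp_bound) auto
      also have "(2 * t)\<^sup>2 \<le> 2 * t * 1"
        unfolding power2_eq_square using t t0 by (intro mult_left_mono) auto
      finally show ?thesis using t0 by simp
    qed
    ultimately have base: "exp (2 * t) \<le> 1 + xi K n (k n) - 2 * C / L" by linarith
    have "real n * exp w \<le> q / (c * real (k n)) * (real n * exp (2 * w))"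
    proof -
      have "1 \<le> q / (c * real (k n)) * exp w"
        using elim(3) assms(1) c(1) k by (simp add: w_def field_simps)
      then have "real n * exp w * 1 \<le> real n * exp w * (q / (c * real (k n)) * exp w)"
        by (intro mult_left_mono) auto
      also have "real n * exp w * (q / (c * real (k n)) * exp w) = q / (c * real (k n)) * (real n * (exp w * exp w))"
        by (simp only: mult_ac)
      also have "exp w * exp w = exp (2 * w)"
        by (simp flip: exp_add)
      finally show ?thesis by simp
    qed
    also have "exp (2 * w) = exp (2 * t) ^ k n"
      using k by (simp add: t_def flip: exp_of_nat_mult)
    also have "q / (c * real (k n)) * (real n * exp (2 * t) ^ k n)
        \<le> q / (c * real (k n)) * (real n * (1 + xi K n (k n) - 2 * C / L) ^ k n)"
      using assms(1) c(1) base by (intro mult_left_mono power_mono) auto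
    also have "\<dots> \<le> real (card (lattice_ball (k n) q (real R)))"
    proof -
      have "0 < exp (2 * t)" by simp
      then have "2 * C / L < 1 + xi K n (k n)" using base by linarith
      then show ?thesis
        unfolding R_def C_def L_def using assms(1) qk elim(4) c
        by (intro card_lattice_ball_floor_ge) auto
    qed
    finally have "min_radius n (k n) q \<le> R"
      unfolding min_radius_def w_def by (rule Least_le)
    moreover have "0 \<le> frakM n (k n) q * (1 + xi K n (k n))"
    proof (rule mult_nonneg_nonneg)
      show "0 \<le> frakM n (k n) q" using C by (simp add: frakM_def C_def)
      have "0 \<le> K * t / 2" using K t0 by simp
      then show "0 \<le> 1 + xi K n (k n)" using xi by linarith
    qed
    ultimately show ?case by (simp add: R_def le_nat_iff)
  qed
qed

text \<open>
As \<open>1 - \<xi> = e\<^bsup>-u\<^esup>\<close> with \<open>k u = K \<omega>\<close>, the count is at most \<open>n e\<^bsup>9 \<omega> - K \<omega>\<^esup> \<le> n e\<^bsup>-\<omega>\<^esup>\<close>.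
\<close>

lemma card_lattice_ball_inner_smallo:
  assumes "1 \<le> q" "10 \<le> K"
  shows "(\<lambda>n. real (card (lattice_ball (k n) q (frakM n (k n) q * (1 - xi K n (k n)))))) \<in> o(\<lambda>n. real n)"
proof (rule landau_o.smallI)
  fix e :: real assume e: "0 < e"
  have "\<forall>\<^sub>F n in sequentially. omega n (k n) / real (k n) < 1 / K"
    using omega_over_dimension assms by (intro order_tendstoD) auto
  moreover have "\<forall>\<^sub>F n in sequentially. - ln e \<le> omega n (k n)"
    using omega_at_top by (simp add: filterlim_at_top)
  moreover have "\<forall>\<^sub>F n in sequentially. 1 \<le> k n"
    using dimension_at_top by (simp add: filterlim_at_top)
  moreover have "\<forall>\<^sub>F n in sequentially. 1 \<le> n"
    by (rule eventually_ge_at_top)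
  ultimately show "\<forall>\<^sub>F n in sequentially.
      norm (real (card (lattice_ball (k n) q (frakM n (k n) q * (1 - xi K n (k n)))))) \<le> e * norm (real n)"
  proof eventually_elim
    case (elim n)
    define w where "w = omega n (k n)"
    define u where "u = K * w / real (k n)"
    have w: "0 \<le> w" unfolding w_def using omega_ge(1)[of "k n" n] by (meson order_trans zero_le_power2)
    have u: "u \<le> 1" using elim(1) assms(2) by (simp add: u_def w_def field_simps)
    have "1 - xi K n (k n) = exp (- u)" by (simp add: xi_def u_def w_def)
    then have "real (card (lattice_ball (k n) q (frakM n (k n) q * (1 - xi K n (k n)))))
        \<le> real n * exp (9 * (real (k n) / real n powr (1 / real (k n))) - real (k n) * u)"
      using card_lattice_ball_inner_le[OF assms(1), of "k n" n u] elim u by simp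
    also have "\<dots> \<le> real n * exp (ln e)"
    proof -
      have "real (k n) / real n powr (1 / real (k n)) \<le> w"
        unfolding w_def using elim(4) by (rule quotient_le_omega)
      moreover have "real (k n) * u = K * w" using elim(3) by (simp add: u_def)
      moreover have "10 * w \<le> K * w" using assms(2) w by (intro mult_right_mono) auto
      ultimately show ?thesis
        using elim(2) by (intro mult_left_mono) (auto simp: w_def)
    qed
    finally show ?case using e by (simp add: mult.commute)
  qed
qed

end

theorem lemmaE:
  fixes q :: real
  assumes "1 \<le> q"
  shows "\<exists>K0::real. \<forall>K\<ge>K0. \<forall>k::nat \<Rightarrow> nat.
           (\<lambda>n. 1) \<in> o(\<lambda>n. real (k n)) \<longrightarrow>
           (\<forall>\<^sub>F n in sequentially. real (k n) \<le> ln (real n) / ln (ln (real n))) \<longrightarrow>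
             (\<forall>\<^sub>F n in sequentially.
                int (min_radius n (k n) q) \<le> \<lfloor>frakM n (k n) q * (1 + xi K n (k n))\<rfloor>) \<and>
             (\<lambda>n. real (card (lattice_ball (k n) q (frakM n (k n) q * (1 - xi K n (k n))))))
               \<in> o(\<lambda>n. real n)"
proof (intro exI[of _ "10 + 4 * C_const q"] allI impI conjI)
  fix K :: real and k :: "nat \<Rightarrow> nat"
  assume K: "10 + 4 * C_const q \<le> K"
    and k: "(\<lambda>n. 1) \<in> o(\<lambda>n. real (k n))"
      "\<forall>\<^sub>F n in sequentially. real (k n) \<le> ln (real n) / ln (ln (real n))"
  show "\<forall>\<^sub>F n in sequentially. int (min_radius n (k n) q) \<le> \<lfloor>frakM n (k n) q * (1 + xi K n (k n))\<rfloor>"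
    using k assms K by (rule min_radius_le_eventually)
  have "10 \<le> K" using K C_const_pos[of q] assms by linarith
  with k assms show "(\<lambda>n. real (card (lattice_ball (k n) q (frakM n (k n) q * (1 - xi K n (k n))))))
      \<in> o(\<lambda>n. real n)"
    by (rule card_lattice_ball_inner_smallo)
qed

end
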